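(* Let $X$ be an involutive BE algebra which is implicative. Then $X$ is a quantum-Wajsberg algebra if and only if $X$ is an implicative-orthomodular algebra.
   Context: A BE algebra is an algebra $(X,\to,1)$ of type $(2,0)$ such that for all $x,y,z\in X$: $x\to x=1$; $x\to 1=1$; $1\to x=x$; $x\to (y\to z)=y\to (x\to z)$. Write $x\le y$ iff $x\to y=1$. It is bounded if there is $0\in X$ with $0\le x$ for all $x\in X$; then $x^*:=x\to 0$. It is involutive if it is bounded and $x^{**}=x$ for all $x\in X$; an involutive BE algebra is denoted $(X,\to,^*,1)$. In an involutive BE algebra define $x\Cap y=((x^*\to y^* )\to y^* )^*$. A BE algebra is implicative if $(x\to y)\to x=x$ for all $x,y\in X$. An involutive BE algebra $X$ is called: - implicative-orthomodular if $x\to (y\Cap (z\Cap x))=(x\to y)\Cap (x\to z)$ for all $x,y,z\in X$; - quantum-Wajsberg if $x\to ((x\Cap y)\Cap (z\Cap x))=(x\to y)\Cap (x\to z)$ for all $x,y,z\in X$; equivalently (known), if both $x\to (x\Cap y)=x\to y$ and $x\to (y\Cap (z\Cap x))=(x\to y)\Cap (x\to z)$ hold for all $x,y,z\in X$. *)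

theory Defs
  imports Main
begin

locale be_algebra =
  fixes X :: "'a set"
    and imp :: "'a \<Rightarrow> 'a \<Rightarrow> 'a" (infixr "\<rightarrow>" 75)
    and one :: 'a ("\<one>")
  assumes imp_closed: "\<lbrakk>x \<in> X; y \<in> X\<rbrakk> \<Longrightarrow> x \<rightarrow> y \<in> X"
    and one_closed: "\<one> \<in> X"
    and imp_self: "x \<in> X \<Longrightarrow> x \<rightarrow> x = \<one>"
    and imp_one: "x \<in> X \<Longrightarrow> x \<rightarrow> \<one> = \<one>"
    and one_imp: "x \<in> X \<Longrightarrow> \<one> \<rightarrow> x = x"
    and imp_exchange:
      "\<lbrakk>x \<in> X; y \<in> X; z \<in> X\<rbrakk> \<Longrightarrow> x \<rightarrow> (y \<rightarrow> z) = y \<rightarrow> (x \<rightarrow> z)"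
begin

definition le :: "'a \<Rightarrow> 'a \<Rightarrow> bool" (infix "\<preceq>" 50)
  where "x \<preceq> y \<longleftrightarrow> x \<rightarrow> y = \<one>"

end

locale implicative_be_algebra = be_algebra +
  assumes implicative: "\<lbrakk>x \<in> X; y \<in> X\<rbrakk> \<Longrightarrow> (x \<rightarrow> y) \<rightarrow> x = x"

text \<open>
  The least element is a locale parameter. The relation \<open>\<preceq>\<close> need not be
  antisymmetric, so a bounded BE algebra may have several candidates for it; in
  the involutive case it is unique, because \<open>z \<preceq> \<zero>\<close> says that the complement
  of \<open>z\<close> is \<open>\<one>\<close>, hence \<open>z\<close> is the complement \<open>\<one> \<rightarrow> \<zero> = \<zero>\<close> of \<open>\<one>\<close>.
\<close>

locale bounded_be_algebra = be_algebra X imp one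
  for X :: "'a set"
    and imp :: "'a \<Rightarrow> 'a \<Rightarrow> 'a" (infixr "\<rightarrow>" 75)
    and zero :: 'a ("\<zero>")
    and one :: 'a ("\<one>") +
  assumes zero_closed: "\<zero> \<in> X"
    and zero_le: "x \<in> X \<Longrightarrow> \<zero> \<preceq> x"
begin

definition compl :: "'a \<Rightarrow> 'a" ("_\<^sup>\<star>" [1000] 1000)
  where "x\<^sup>\<star> = x \<rightarrow> \<zero>"

end

locale involutive_be_algebra = bounded_be_algebra +
  assumes involutive: "x \<in> X \<Longrightarrow> (x\<^sup>\<star>)\<^sup>\<star> = x"
begin

text \<open>
  Despite the symbol, \<open>\<sqinter>\<close> is not commutative in general: in an orthomodular
  lattice with \<open>x \<rightarrow> y\<close> the join of the complement of \<open>x\<close> with \<open>y\<close>, it is the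
  Sasaki projection of \<open>x\<close> to \<open>y\<close>.
\<close>

definition cap :: "'a \<Rightarrow> 'a \<Rightarrow> 'a" (infixl "\<sqinter>" 80)
  where "x \<sqinter> y = ((x\<^sup>\<star> \<rightarrow> y\<^sup>\<star>) \<rightarrow> y\<^sup>\<star>)\<^sup>\<star>"

end

locale implicative_orthomodular_algebra = involutive_be_algebra +
  assumes implicative_orthomodular:
    "\<lbrakk>x \<in> X; y \<in> X; z \<in> X\<rbrakk> \<Longrightarrow>
      x \<rightarrow> (y \<sqinter> (z \<sqinter> x)) = (x \<rightarrow> y) \<sqinter> (x \<rightarrow> z)"

locale quantum_wajsberg_algebra = involutive_be_algebra +
  assumes quantum_wajsberg:
    "\<lbrakk>x \<in> X; y \<in> X; z \<in> X\<rbrakk> \<Longrightarrow>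
      x \<rightarrow> ((x \<sqinter> y) \<sqinter> (z \<sqinter> x)) = (x \<rightarrow> y) \<sqinter> (x \<rightarrow> z)"

end

theory Submission
  imports Defs
begin

text \<open>
  An implicative involutive BE algebra is an ortholattice with join \<open>x\<^sup>\<star> \<rightarrow> y\<close>, and
  \<open>x \<sqinter> y\<close> is the Sasaki projection of \<open>x\<close> to \<open>y\<close>. Putting \<open>y = \<one>\<close> in either of the
  two defining identities gives the orthomodular law. Conversely, in an orthomodular
  lattice put \<open>w = z \<sqinter> x\<close>; the implicative-orthomodular identity becomes
  \<open>x\<^sup>\<star> \<or> (w \<and> c) = (x\<^sup>\<star> \<or> w) \<and> c\<close> for \<open>c = w\<^sup>\<star> \<or> y\<close>, where \<open>w\<close> lies below \<open>x\<close> and \<open>c\<close> lies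
  above \<open>x\<^sup>\<star>\<close>, an instance of distributivity of commuting elements. The quantum-Wajsberg
  identity follows from it by \<open>x \<rightarrow> (x \<sqinter> y) = x \<rightarrow> y\<close>.
\<close>

locale implicative_involutive_be_algebra =
  involutive_be_algebra X imp zero one + implicative_be_algebra X imp one
  for X :: "'a set"
    and imp :: "'a \<Rightarrow> 'a \<Rightarrow> 'a" (infixr "\<rightarrow>" 75)
    and zero :: 'a ("\<zero>")
    and one :: 'a ("\<one>")
begin

section \<open>The underlying ortholattice\<close>

definition join :: "'a \<Rightarrow> 'a \<Rightarrow> 'a" (infixl "\<^bold>\<or>" 65)
  where "x \<^bold>\<or> y = x\<^sup>\<star> \<rightarrow> y"

definition meet :: "'a \<Rightarrow> 'a \<Rightarrow> 'a" (infixl "\<^bold>\<and>" 70)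
  where "x \<^bold>\<and> y = (x\<^sup>\<star> \<^bold>\<or> y\<^sup>\<star>)\<^sup>\<star>"

lemma compl_closed [simp]: "x \<in> X \<Longrightarrow> x\<^sup>\<star> \<in> X"
  by (simp add: compl_def imp_closed zero_closed)

lemma join_closed [simp]: "\<lbrakk>x \<in> X; y \<in> X\<rbrakk> \<Longrightarrow> x \<^bold>\<or> y \<in> X"
  by (simp add: join_def imp_closed)

lemma meet_closed [simp]: "\<lbrakk>x \<in> X; y \<in> X\<rbrakk> \<Longrightarrow> x \<^bold>\<and> y \<in> X"
  by (simp add: meet_def)

lemmas [simp] = one_closed zero_closed involutive

text \<open>This is contraposition: writing \<open>y\<close> as
  \<open>y\<^sup>\<star> \<rightarrow> \<zero>\<close>, the exchange law swaps the premises
  \<open>x\<^sup>\<star>\<close> and \<open>y\<^sup>\<star>\<close>.\<close>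

lemma join_commute: "\<lbrakk>x \<in> X; y \<in> X\<rbrakk> \<Longrightarrow> x \<^bold>\<or> y = y \<^bold>\<or> x"
  using imp_exchange[of "x\<^sup>\<star>" "y\<^sup>\<star>" \<zero>] involutive[of x] involutive[of y]
  by (simp add: join_def compl_def imp_closed)

lemma join_left_commute:
  "\<lbrakk>x \<in> X; y \<in> X; z \<in> X\<rbrakk> \<Longrightarrow> x \<^bold>\<or> (y \<^bold>\<or> z) = y \<^bold>\<or> (x \<^bold>\<or> z)"
  by (simp add: join_def imp_exchange)

lemma join_assoc: "\<lbrakk>x \<in> X; y \<in> X; z \<in> X\<rbrakk> \<Longrightarrow> x \<^bold>\<or> y \<^bold>\<or> z = x \<^bold>\<or> (y \<^bold>\<or> z)"
  by (metis join_commute join_left_commute join_closed)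

lemmas join_ac = join_assoc join_commute join_left_commute

lemma compl_meet: "\<lbrakk>x \<in> X; y \<in> X\<rbrakk> \<Longrightarrow> (x \<^bold>\<and> y)\<^sup>\<star> = x\<^sup>\<star> \<^bold>\<or> y\<^sup>\<star>"
  by (simp add: meet_def)

lemma compl_join: "\<lbrakk>x \<in> X; y \<in> X\<rbrakk> \<Longrightarrow> (x \<^bold>\<or> y)\<^sup>\<star> = x\<^sup>\<star> \<^bold>\<and> y\<^sup>\<star>"
  by (simp add: meet_def)

lemma meet_commute: "\<lbrakk>x \<in> X; y \<in> X\<rbrakk> \<Longrightarrow> x \<^bold>\<and> y = y \<^bold>\<and> x"
  by (simp add: meet_def join_commute)

lemma meet_left_commute:
  "\<lbrakk>x \<in> X; y \<in> X; z \<in> X\<rbrakk> \<Longrightarrow> x \<^bold>\<and> (y \<^bold>\<and> z) = y \<^bold>\<and> (x \<^bold>\<and> z)"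
  by (simp add: meet_def join_left_commute)

lemma meet_assoc: "\<lbrakk>x \<in> X; y \<in> X; z \<in> X\<rbrakk> \<Longrightarrow> x \<^bold>\<and> y \<^bold>\<and> z = x \<^bold>\<and> (y \<^bold>\<and> z)"
  by (simp add: meet_def join_assoc)

lemmas meet_ac = meet_assoc meet_commute meet_left_commute

lemma imp_eq_join: "x \<in> X \<Longrightarrow> x \<rightarrow> y = x\<^sup>\<star> \<^bold>\<or> y"
  by (simp add: join_def)

text \<open>The implicative law enters here and nowhere else: with \<open>y\<^sup>\<star>\<close>
  for its second variable it reads as absorption. The dual law follows by De Morgan.\<close>

lemma join_meet_absorb:
  assumes "x \<in> X" "y \<in> X"
  shows "x \<^bold>\<or> (x \<^bold>\<and> y) = x"
proof -
  have "(x \<rightarrow> y\<^sup>\<star>) \<rightarrow> x = x"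
    using assms by (simp add: implicative)
  then show ?thesis
    using assms by (simp add: imp_eq_join imp_closed compl_join join_commute)
qed

lemma meet_join_absorb: "\<lbrakk>x \<in> X; y \<in> X\<rbrakk> \<Longrightarrow> x \<^bold>\<and> (x \<^bold>\<or> y) = x"
  using join_meet_absorb[of "x\<^sup>\<star>" "y\<^sup>\<star>"] by (simp add: meet_def)

lemma one_compl [simp]: "\<one>\<^sup>\<star> = \<zero>"
  by (simp add: compl_def one_imp)

lemma zero_compl [simp]: "\<zero>\<^sup>\<star> = \<one>"
  by (simp add: compl_def imp_self)

lemma join_one [simp]: "x \<in> X \<Longrightarrow> x \<^bold>\<or> \<one> = \<one>"
  by (simp add: join_def imp_one)

lemma join_zero [simp]: "x \<in> X \<Longrightarrow> x \<^bold>\<or> \<zero> = x"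
  using involutive[of x] by (simp add: join_def compl_def)

lemma zero_join [simp]: "x \<in> X \<Longrightarrow> \<zero> \<^bold>\<or> x = x"
  by (simp add: join_def one_imp)

lemma meet_one [simp]: "x \<in> X \<Longrightarrow> x \<^bold>\<and> \<one> = x"
  by (simp add: meet_def)

lemma one_meet [simp]: "x \<in> X \<Longrightarrow> \<one> \<^bold>\<and> x = x"
  by (simp add: meet_def)

lemma compl_join_self [simp]: "x \<in> X \<Longrightarrow> x\<^sup>\<star> \<^bold>\<or> x = \<one>"
  by (simp add: join_def imp_self)

lemma meet_compl [simp]: "x \<in> X \<Longrightarrow> x \<^bold>\<and> x\<^sup>\<star> = \<zero>"
  by (simp add: meet_def join_def imp_self)

section \<open>Sasaki projections and the orthomodular law\<close>

lemma cap_eq: "\<lbrakk>x \<in> X; y \<in> X\<rbrakk> \<Longrightarrow> x \<sqinter> y = y \<^bold>\<and> (y\<^sup>\<star> \<^bold>\<or> x)"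
  by (simp add: cap_def imp_eq_join compl_join compl_meet join_commute)

lemma cap_closed [simp]: "\<lbrakk>x \<in> X; y \<in> X\<rbrakk> \<Longrightarrow> x \<sqinter> y \<in> X"
  by (simp add: cap_eq)

lemma cap_one [simp]: "x \<in> X \<Longrightarrow> x \<sqinter> \<one> = x"
  by (simp add: cap_eq)

lemma one_cap [simp]: "x \<in> X \<Longrightarrow> \<one> \<sqinter> x = x"
  by (simp add: cap_eq)

lemma join_idem: "x \<in> X \<Longrightarrow> x \<^bold>\<or> x = x"
  using join_meet_absorb[of x \<one>] by simp

text \<open>The element \<open>z \<sqinter> x\<close> lies below \<open>x\<close>, so
  \<open>x\<close> projects onto all of it.\<close>

lemma cap_cap_same:
  assumes "x \<in> X" "z \<in> X"
  shows "x \<sqinter> (z \<sqinter> x) = z \<sqinter> x"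
proof -
  let ?w = "z \<sqinter> x"
  have "?w\<^sup>\<star> \<^bold>\<or> x = (x\<^sup>\<star> \<^bold>\<or> z)\<^sup>\<star> \<^bold>\<or> (x\<^sup>\<star> \<^bold>\<or> x)"
    using assms by (simp add: cap_eq compl_meet join_ac)
  also have "\<dots> = \<one>"
    using assms by simp
  finally have "?w\<^sup>\<star> \<^bold>\<or> x = \<one>" .
  then show ?thesis
    using assms by (simp add: cap_eq[of x ?w])
qed

text \<open>The usual law assumes that the first element is below the second. Taking
  \<open>x \<or> y\<close> as the second makes it an unconditional equation.\<close>

definition orthomodular :: bool
  where "orthomodular \<longleftrightarrow> (\<forall>x\<in>X. \<forall>y\<in>X. x \<^bold>\<or> (x\<^sup>\<star> \<^bold>\<and> (x \<^bold>\<or> y)) = x \<^bold>\<or> y)"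

lemma orthomodularI:
  assumes "\<And>x z. \<lbrakk>x \<in> X; z \<in> X\<rbrakk> \<Longrightarrow> x \<rightarrow> (z \<sqinter> x) = x \<rightarrow> z"
  shows "orthomodular"
  unfolding orthomodular_def
proof (intro ballI)
  fix x y assume "x \<in> X" "y \<in> X"
  then show "x \<^bold>\<or> (x\<^sup>\<star> \<^bold>\<and> (x \<^bold>\<or> y)) = x \<^bold>\<or> y"
    using assms[of "x\<^sup>\<star>" y] by (simp add: cap_eq imp_eq_join)
qed

lemma quantum_wajsberg_imp_orthomodular:
  assumes "quantum_wajsberg_algebra X imp zero one"
  shows "orthomodular"
proof (rule orthomodularI)
  fix x z assume "x \<in> X" "z \<in> X"
  then show "x \<rightarrow> (z \<sqinter> x) = x \<rightarrow> z"
    \<comment> \<open>For \<open>y = \<one>\<close> the left side is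
      \<open>x \<rightarrow> (x \<sqinter> (z \<sqinter> x))\<close>, which
      \<open>cap_cap_same\<close> collapses; the right side is
      \<open>\<one> \<sqinter> (x \<rightarrow> z)\<close>.\<close>
    using quantum_wajsberg_algebra.quantum_wajsberg[OF assms, of x \<one> z]
    by (simp add: cap_cap_same imp_one imp_closed)
qed

lemma implicative_orthomodular_imp_orthomodular:
  assumes "implicative_orthomodular_algebra X imp zero one"
  shows "orthomodular"
proof (rule orthomodularI)
  fix x z assume "x \<in> X" "z \<in> X"
  then show "x \<rightarrow> (z \<sqinter> x) = x \<rightarrow> z"
    using implicative_orthomodular_algebra.implicative_orthomodular[OF assms, of x \<one> z]
    by (simp add: imp_one imp_closed)
qed

section \<open>Both identities from the orthomodular law\<close>

context
  assumes orthomodular: "orthomodular"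
begin

lemma orthomodular_law: "\<lbrakk>x \<in> X; y \<in> X\<rbrakk> \<Longrightarrow> x \<^bold>\<or> (x\<^sup>\<star> \<^bold>\<and> (x \<^bold>\<or> y)) = x \<^bold>\<or> y"
  using orthomodular by (simp add: orthomodular_def)

lemma orthomodular_law_dual:
  assumes "x \<in> X" "y \<in> X"
  shows "x \<^bold>\<and> (x\<^sup>\<star> \<^bold>\<or> (x \<^bold>\<and> y)) = x \<^bold>\<and> y"
  using orthomodular_law[of "x\<^sup>\<star>" "y\<^sup>\<star>"] assms by (simp add: meet_def)

text \<open>If \<open>d\<close> is below \<open>e\<close>, the law splits \<open>e\<close> into
  \<open>d\<close> and \<open>d\<^sup>\<star> \<and> e\<close>. An equation thus reduces to one
  inequality and one vanishing meet.\<close>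

lemma eq_of_le_of_meet_compl:
  assumes "d \<in> X" "e \<in> X" "d \<^bold>\<or> e = e" "d\<^sup>\<star> \<^bold>\<and> e = \<zero>"
  shows "d = e"
  using orthomodular_law[of d e] assms by simp

text \<open>The inequality from left to right holds in every lattice with
  \<open>x\<^sup>\<star>\<close> below \<open>c\<close>; orthomodularity is what makes the gap
  between the sides vanish.\<close>

lemma join_meet_distrib_compl:
  assumes X: "x \<in> X" "w \<in> X" "c \<in> X"
    and w: "x \<^bold>\<and> w = w" and c: "x\<^sup>\<star> \<^bold>\<or> c = c"
  shows "x\<^sup>\<star> \<^bold>\<or> (w \<^bold>\<and> c) = (x\<^sup>\<star> \<^bold>\<or> w) \<^bold>\<and> c"
proof (rule eq_of_le_of_meet_compl)
  let ?m = "w \<^bold>\<and> c" and ?j = "x\<^sup>\<star> \<^bold>\<or> w"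
  have cm: "c \<^bold>\<or> ?m = c" and wm: "w \<^bold>\<or> ?m = w"
    using X join_meet_absorb[of c w] join_meet_absorb[of w c] by (simp_all add: meet_commute)
  let ?d = "x\<^sup>\<star> \<^bold>\<or> ?m"
  have dj: "?d \<^bold>\<or> ?j = ?j"
    using X wm by (metis join_assoc join_commute join_idem compl_closed join_closed meet_closed)
  have dc: "?d \<^bold>\<or> c = c"
    using X cm c by (metis join_assoc join_commute compl_closed meet_closed)
  have "?d \<^bold>\<and> (?j \<^bold>\<and> c) = ?d"
    using X meet_join_absorb[of ?d ?j] meet_join_absorb[of ?d c]
    by (simp add: dj dc flip: meet_assoc)
  then show "?d \<^bold>\<or> (?j \<^bold>\<and> c) = ?j \<^bold>\<and> c"
    using X join_meet_absorb[of "?j \<^bold>\<and> c" ?d]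
    by (simp add: join_commute[of ?d] meet_commute[of ?d])
  have xj: "x \<^bold>\<and> ?j = w"
    using orthomodular_law_dual[of x w] X w by simp
  \<comment> \<open>Since \<open>?d\<^sup>\<star>\<close> is
    \<open>x \<and> ?m\<^sup>\<star>\<close>, its factor \<open>x\<close> can be moved next to
    \<open>?j\<close>, where \<open>xj\<close> leaves \<open>w\<close>. Then \<open>?m\<close> meets
    its own complement.\<close>
  have "?d\<^sup>\<star> \<^bold>\<and> (?j \<^bold>\<and> c) = ((x \<^bold>\<and> ?j) \<^bold>\<and> c) \<^bold>\<and> ?m\<^sup>\<star>"
    using X by (simp add: compl_join meet_ac)
  then show "?d\<^sup>\<star> \<^bold>\<and> (?j \<^bold>\<and> c) = \<zero>"
    using X by (simp add: xj)
qed (use X in simp_all)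

lemma implicative_orthomodular_identity:
  assumes X: "x \<in> X" "y \<in> X" "z \<in> X"
  shows "x \<rightarrow> (y \<sqinter> (z \<sqinter> x)) = (x \<rightarrow> y) \<sqinter> (x \<rightarrow> z)"
proof -
  define w where "w = z \<sqinter> x"
  have wX [simp]: "w \<in> X"
    using X by (simp add: w_def)
  have w: "w = x \<^bold>\<and> (x\<^sup>\<star> \<^bold>\<or> z)" and w_compl: "w\<^sup>\<star> = x\<^sup>\<star> \<^bold>\<or> (x\<^sup>\<star> \<^bold>\<or> z)\<^sup>\<star>"
    using X by (simp_all add: w_def cap_eq compl_meet)
  let ?c = "w\<^sup>\<star> \<^bold>\<or> y"
  have xw: "x \<^bold>\<and> w = w"
    unfolding w using X by (metis meet_assoc meet_join_absorb join_idem compl_closed join_closed)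
  \<comment> \<open>As \<open>w\<close> is below \<open>x\<close>, its complement already contains
    \<open>x\<^sup>\<star>\<close>.\<close>
  have xc: "x\<^sup>\<star> \<^bold>\<or> ?c = ?c"
    unfolding w_compl using X by (metis join_assoc join_idem compl_closed join_closed)
  have "x \<rightarrow> (y \<sqinter> w) = x\<^sup>\<star> \<^bold>\<or> (w \<^bold>\<and> ?c)"
    using X by (simp add: imp_eq_join cap_eq)
  also have "\<dots> = (x\<^sup>\<star> \<^bold>\<or> w) \<^bold>\<and> ?c"
    using X xw xc by (simp add: join_meet_distrib_compl)
  \<comment> \<open>By the orthomodular law, projecting \<open>z\<close> to \<open>x\<close> loses
    nothing modulo \<open>x\<^sup>\<star>\<close>.\<close>
  also have "x\<^sup>\<star> \<^bold>\<or> w = x\<^sup>\<star> \<^bold>\<or> z"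
    unfolding w using X orthomodular_law[of "x\<^sup>\<star>" z] by simp
  also have "?c = (x\<^sup>\<star> \<^bold>\<or> z)\<^sup>\<star> \<^bold>\<or> (x\<^sup>\<star> \<^bold>\<or> y)"
    unfolding w_compl using X by (simp add: join_ac)
  also have "(x\<^sup>\<star> \<^bold>\<or> z) \<^bold>\<and> \<dots> = (x \<rightarrow> y) \<sqinter> (x \<rightarrow> z)"
    using X by (simp add: imp_eq_join cap_eq)
  finally show ?thesis
    by (simp add: w_def)
qed

text \<open>\<open>y\<close> is the join of its part \<open>x \<sqinter> y\<close> and of \<open>y \<and> x\<^sup>\<star>\<close>, which \<open>x\<^sup>\<star>\<close> absorbs.\<close>

lemma imp_cap:
  assumes X: "x \<in> X" "y \<in> X"
  shows "x \<rightarrow> (x \<sqinter> y) = x \<rightarrow> y"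
proof -
  let ?p = "x \<sqinter> y"
  have p: "?p = y \<^bold>\<and> (y\<^sup>\<star> \<^bold>\<or> x)"
    using X by (simp add: cap_eq)
  have py: "?p \<^bold>\<or> y = y"
    unfolding p using X join_meet_absorb[of y "y\<^sup>\<star> \<^bold>\<or> x"] by (simp add: join_commute)
  \<comment> \<open>The complement of \<open>?p\<close> relative to \<open>y\<close> is the second
    part in the splitting of \<open>y\<close>; the dual law simplifies it.\<close>
  have "?p\<^sup>\<star> \<^bold>\<and> y = y \<^bold>\<and> (y\<^sup>\<star> \<^bold>\<or> (y \<^bold>\<and> x\<^sup>\<star>))"
    unfolding p using X by (simp add: compl_meet compl_join meet_commute)
  also have "\<dots> = y \<^bold>\<and> x\<^sup>\<star>"
    using X by (simp add: orthomodular_law_dual)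
  finally have "?p \<^bold>\<or> (y \<^bold>\<and> x\<^sup>\<star>) = y"
    using orthomodular_law[of ?p y] X py by simp
  then have "x\<^sup>\<star> \<^bold>\<or> y = x\<^sup>\<star> \<^bold>\<or> (x\<^sup>\<star> \<^bold>\<and> y) \<^bold>\<or> ?p"
    using X by (metis join_assoc join_commute meet_commute cap_closed compl_closed meet_closed)
  then show ?thesis
    using X by (simp add: imp_eq_join join_meet_absorb)
qed

lemma quantum_wajsberg_identity:
  assumes "x \<in> X" "y \<in> X" "z \<in> X"
  shows "x \<rightarrow> ((x \<sqinter> y) \<sqinter> (z \<sqinter> x)) = (x \<rightarrow> y) \<sqinter> (x \<rightarrow> z)"
  using assms implicative_orthomodular_identity[of x "x \<sqinter> y" z] by (simp add: imp_cap)

end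

lemma quantum_wajsberg_iff_orthomodular:
  "quantum_wajsberg_algebra X imp zero one \<longleftrightarrow> orthomodular"
  using quantum_wajsberg_imp_orthomodular
  by (auto intro!: quantum_wajsberg_algebra.intro quantum_wajsberg_algebra_axioms.intro
      quantum_wajsberg_identity involutive_be_algebra_axioms)

lemma implicative_orthomodular_iff_orthomodular:
  "implicative_orthomodular_algebra X imp zero one \<longleftrightarrow> orthomodular"
  using implicative_orthomodular_imp_orthomodular
  by (auto intro!: implicative_orthomodular_algebra.intro
      implicative_orthomodular_algebra_axioms.intro
      implicative_orthomodular_identity involutive_be_algebra_axioms)

end

theorem corollary3p17:
  fixes X :: "'a set"
    and imp :: "'a \<Rightarrow> 'a \<Rightarrow> 'a"
    and zero one :: 'a
  assumes "involutive_be_algebra X imp zero one"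
    and "implicative_be_algebra X imp one"
  shows "quantum_wajsberg_algebra X imp zero one \<longleftrightarrow>
    implicative_orthomodular_algebra X imp zero one"
proof -
  interpret implicative_involutive_be_algebra X imp zero one
    using assms by (rule implicative_involutive_be_algebra.intro)
  show ?thesis
    by (simp add: quantum_wajsberg_iff_orthomodular implicative_orthomodular_iff_orthomodular)
qed

end
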